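(* Let $p>q$ be prime numbers with $p\equiv1\pmod q$, let $g$ be an integer whose multiplicative order modulo $p$ is $q$, and let $G=\{\sigma^i\tau^j\mid 0\le i\le p-1,\ 0\le j\le q-1\}$ be the nonabelian group of order $pq$ with $\sigma$ of order $p$, $\tau$ of order $q$ and $\tau\sigma\tau^{-1}=\sigma^g$. Let $N=\langle\eta,\pi\rangle\le\mathrm{Perm}(G)$, where $\eta(\sigma^k\tau^\ell)=\sigma^{k+1}\tau^\ell$ and $\pi(\sigma^k\tau^\ell)=\sigma^k\tau^{\ell+1}$, let $\psi\in\mathrm{Aut}(G)$ be given by $\psi(\sigma)=\sigma$, $\psi(\tau)=\sigma\tau$, and for $0\le s\le p-1$ let $N_s=\psi^{-s}N\psi^s$. Then the subgroups $N_s$ ($0\le s\le p-1$) are $\rho$-conjugate to one another and mutually $G$-isomorphic.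
   Context: $\mathrm{Perm}(G)$ is the group of permutations of $G$; $\lambda,\rho:G\to\mathrm{Perm}(G)$ are given by $\lambda(x)[y]=xy$ and $\rho(x)[y]=yx^{-1}$. $G$ acts on $\mathrm{Perm}(G)$ by ${}^{x}\pi=\lambda(x)\pi\lambda(x)^{-1}$. A subgroup of $\mathrm{Perm}(G)$ is regular if it acts transitively on $G$ with trivial stabilizers, and $G$-stable if it is preserved by this action. Two regular $G$-stable subgroups $N,M$ are $\rho$-conjugate if $M=\rho(x)N\rho(x)^{-1}$ for some $x\in G$, and $G$-isomorphic if there is a group isomorphism $\theta:N\to M$ with $\theta({}^{x}\nu)={}^{x}\theta(\nu)$ for all $\nu\in N$, $x\in G$. The subgroups $N_s$ are regular, $G$-stable and cyclic of order $pq$. Automorphisms of $G$ are regarded as elements of $\mathrm{Perm}(G)$. *)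

theory Defs
  imports
    "HOL-Algebra.Generated_Groups"
    "HOL-Algebra.Group_Action"
    "HOL-Number_Theory.Pocklington"
begin

abbreviation Perm :: "('a, 'b) monoid_scheme \<Rightarrow> ('a \<Rightarrow> 'a) monoid" where
  "Perm G \<equiv> BijGroup (carrier G)"

text \<open>Permutations are the extensional bijections of \<open>carrier G\<close>, multiplied by
  composition, so the maps below are restricted to the carrier.\<close>

definition left_mult :: "('a, 'b) monoid_scheme \<Rightarrow> 'a \<Rightarrow> 'a \<Rightarrow> 'a" where
  "left_mult G x = (\<lambda>y\<in>carrier G. x \<otimes>\<^bsub>G\<^esub> y)"

definition right_mult :: "('a, 'b) monoid_scheme \<Rightarrow> 'a \<Rightarrow> 'a \<Rightarrow> 'a" where
  "right_mult G x = (\<lambda>y\<in>carrier G. y \<otimes>\<^bsub>G\<^esub> inv\<^bsub>G\<^esub> x)"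

definition perm_act :: "('a, 'b) monoid_scheme \<Rightarrow> 'a \<Rightarrow> ('a \<Rightarrow> 'a) \<Rightarrow> ('a \<Rightarrow> 'a)" where
  "perm_act G x \<pi> =
     left_mult G x \<otimes>\<^bsub>Perm G\<^esub> \<pi> \<otimes>\<^bsub>Perm G\<^esub> inv\<^bsub>Perm G\<^esub> (left_mult G x)"

definition regular_subgroup :: "('a, 'b) monoid_scheme \<Rightarrow> ('a \<Rightarrow> 'a) set \<Rightarrow> bool" where
  "regular_subgroup G N \<longleftrightarrow>
     subgroup N (Perm G) \<and>
     transitive_action ((Perm G)\<lparr>carrier := N\<rparr>) (carrier G) (\<lambda>\<nu>. \<nu>) \<and>
     (\<forall>y\<in>carrier G.
        stabilizer ((Perm G)\<lparr>carrier := N\<rparr>) (\<lambda>\<nu>. \<nu>) y = {\<one>\<^bsub>Perm G\<^esub>})"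

definition G_stable :: "('a, 'b) monoid_scheme \<Rightarrow> ('a \<Rightarrow> 'a) set \<Rightarrow> bool" where
  "G_stable G N \<longleftrightarrow> (\<forall>x\<in>carrier G. \<forall>\<nu>\<in>N. perm_act G x \<nu> \<in> N)"

text \<open>The next two relations are relations between regular \<open>G\<close>-stable subgroups; this
  is part of their definition.\<close>

definition rho_conjugate ::
  "('a, 'b) monoid_scheme \<Rightarrow> ('a \<Rightarrow> 'a) set \<Rightarrow> ('a \<Rightarrow> 'a) set \<Rightarrow> bool" where
  "rho_conjugate G N M \<longleftrightarrow>
     regular_subgroup G N \<and> G_stable G N \<and> regular_subgroup G M \<and> G_stable G M \<and>
     (\<exists>x\<in>carrier G.
        M = right_mult G x <#\<^bsub>Perm G\<^esub> N #>\<^bsub>Perm G\<^esub> inv\<^bsub>Perm G\<^esub> (right_mult G x))"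

definition G_isomorphic ::
  "('a, 'b) monoid_scheme \<Rightarrow> ('a \<Rightarrow> 'a) set \<Rightarrow> ('a \<Rightarrow> 'a) set \<Rightarrow> bool" where
  "G_isomorphic G N M \<longleftrightarrow>
     regular_subgroup G N \<and> G_stable G N \<and> regular_subgroup G M \<and> G_stable G M \<and>
     (\<exists>\<theta>\<in>iso ((Perm G)\<lparr>carrier := N\<rparr>) ((Perm G)\<lparr>carrier := M\<rparr>).
        \<forall>x\<in>carrier G. \<forall>\<nu>\<in>N. \<theta> (perm_act G x \<nu>) = perm_act G x (\<theta> \<nu>))"

definition conj_subgroup ::
  "('a, 'b) monoid_scheme \<Rightarrow> ('a \<Rightarrow> 'a) \<Rightarrow> ('a \<Rightarrow> 'a) set \<Rightarrow> nat \<Rightarrow> ('a \<Rightarrow> 'a) set" where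
  "conj_subgroup G \<psi> N s =
     \<psi> [^]\<^bsub>Perm G\<^esub> (- int s) <#\<^bsub>Perm G\<^esub> N #>\<^bsub>Perm G\<^esub> \<psi> [^]\<^bsub>Perm G\<^esub> s"

end

theory Submission
  imports Defs
begin

text \<open>The two generators of \<open>N\<close> are translations: \<open>\<eta> = \<lambda>(\<sigma>)\<close> and \<open>\<pi> = \<rho>(\<tau>\<^sup>-\<^sup>1)\<close>. They commute, and
  products of their powers take \<open>1\<close> to every \<open>\<sigma>\<^sup>i \<tau>\<^sup>j\<close>, so \<open>N\<close> is a transitive commutative group
  and therefore regular; it is \<open>G\<close>-stable because \<open>\<langle>\<sigma>\<rangle>\<close> is normal in \<open>G\<close>
  (\<open>generate_translations_regular_stable\<close>).

  The automorphism \<open>\<psi>\<close> is inner. Conjugation by \<open>\<sigma>\<^sup>m\<close> fixes \<open>\<sigma>\<close> and takes \<open>\<tau>\<close> to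
  \<open>\<sigma>\<close> to the power \<open>m (1 - g)\<close>, times \<open>\<tau>\<close>. As \<open>g\<close> is not \<open>1\<close> modulo \<open>p\<close>, some \<open>m\<close> has
  \<open>m (1 - g) = 1\<close> modulo \<open>p\<close>; for \<open>c = \<sigma>\<^sup>m\<close> this gives \<open>\<psi> = \<lambda>(c) \<rho>(c)\<close>. Here \<open>\<lambda>(c) = \<eta>\<^sup>m\<close> lies in
  \<open>N\<close> and conjugates it to itself, and it commutes with \<open>\<rho>(c)\<close>, so
  \<open>N\<^sub>s = \<psi>\<^sup>-\<^sup>s N \<psi>\<^sup>s = \<rho>(c\<^sup>-\<^sup>s) N \<rho>(c\<^sup>-\<^sup>s)\<^sup>-\<^sup>1\<close>
  (\<open>conj_subgroup_inner_eq_rho_conjugate\<close>). All the \<open>N\<^sub>s\<close> are thus \<open>\<rho>\<close>-conjugate to \<open>N\<close>, hence to one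
  another.

  Finally, \<open>\<rho>\<close>-conjugate subgroups are always \<open>G\<close>-isomorphic: the action of \<open>G\<close> is conjugation by
  left translations, which commutes with conjugation by right translations
  (\<open>rho_conjugate_and_G_isomorphic\<close>).\<close>

section \<open>Conjugates and cosets\<close>

lemma (in group) conj_coset_eq_image:
  "a <# H #> b = (\<lambda>x. a \<otimes> x \<otimes> b) ` H"
  by (auto simp: l_coset_def r_coset_def)

lemma (in group) group_hom_conj:
  assumes "a \<in> carrier G"
  shows "group_hom G G (\<lambda>x. a \<otimes> x \<otimes> inv a)"
proof (intro group_hom.intro group_hom_axioms.intro homI is_group)
  fix x y assume xy: "x \<in> carrier G" "y \<in> carrier G"
  have "a \<otimes> x \<otimes> inv a \<otimes> (a \<otimes> y \<otimes> inv a) = a \<otimes> x \<otimes> (inv a \<otimes> a) \<otimes> y \<otimes> inv a"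
    using assms xy by (simp only: m_assoc m_closed inv_closed)
  then show "a \<otimes> (x \<otimes> y) \<otimes> inv a = a \<otimes> x \<otimes> inv a \<otimes> (a \<otimes> y \<otimes> inv a)"
    using assms xy by (simp add: m_assoc)
qed (use assms in simp)

lemma (in group) conj_conj:
  assumes "a \<in> carrier G" "b \<in> carrier G" "x \<in> carrier G"
  shows "a \<otimes> (b \<otimes> x \<otimes> inv b) \<otimes> inv a = (a \<otimes> b) \<otimes> x \<otimes> inv (a \<otimes> b)"
  using assms by (simp add: m_assoc inv_mult_group)

lemma (in group) conj_set_shift:
  assumes "a \<in> carrier G" "b \<in> carrier G" "H \<subseteq> carrier G"
  shows "b <# H #> inv b = (b \<otimes> inv a) <# (a <# H #> inv a) #> inv (b \<otimes> inv a)"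
proof -
  have "(b \<otimes> inv a) \<otimes> (a \<otimes> x \<otimes> inv a) \<otimes> inv (b \<otimes> inv a) = b \<otimes> x \<otimes> inv b" if "x \<in> H" for x
  proof -
    have x: "x \<in> carrier G" using assms that by auto
    have "(b \<otimes> inv a) \<otimes> (a \<otimes> x \<otimes> inv a) \<otimes> inv (b \<otimes> inv a)
        = ((b \<otimes> inv a) \<otimes> a) \<otimes> x \<otimes> inv ((b \<otimes> inv a) \<otimes> a)"
      using assms x by (intro conj_conj) auto
    also have "(b \<otimes> inv a) \<otimes> a = b" using assms by (simp add: m_assoc)
    finally show ?thesis .
  qed
  then show ?thesis
    by (simp add: conj_coset_eq_image image_image cong: image_cong)
qed

text \<open>Centralizers are subgroups, and this is used twice: the centralizer of \<open>S\<close> contains \<open>S\<close>, hence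
  \<open>\<langle>S\<rangle>\<close>; so the centralizer of \<open>\<langle>S\<rangle>\<close> contains \<open>S\<close>, hence \<open>\<langle>S\<rangle>\<close>.\<close>

lemma (in group) generate_commute:
  assumes S: "S \<subseteq> carrier G" and "\<And>a b. a \<in> S \<Longrightarrow> b \<in> S \<Longrightarrow> a \<otimes> b = b \<otimes> a"
    and x: "x \<in> generate G S" and y: "y \<in> generate G S"
  shows "x \<otimes> y = y \<otimes> x"
proof -
  have centralizer: "subgroup {z \<in> carrier G. \<forall>a\<in>A. a \<otimes> z = z \<otimes> a} G"
    if "A \<subseteq> carrier G" for A
  proof (intro subgroupI)
    fix z assume "z \<in> {z \<in> carrier G. \<forall>a\<in>A. a \<otimes> z = z \<otimes> a}"
    then have z: "z \<in> carrier G" and c: "\<And>a. a \<in> A \<Longrightarrow> a \<otimes> z = z \<otimes> a" by auto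
    have "a \<otimes> inv z = inv z \<otimes> a" if "a \<in> A" for a
    proof -
      have a: "a \<in> carrier G" using that \<open>A \<subseteq> carrier G\<close> by auto
      have "a \<otimes> inv z = inv z \<otimes> (z \<otimes> a) \<otimes> inv z" using a z by (simp add: m_assoc[symmetric])
      also have "\<dots> = inv z \<otimes> a" using a z by (simp add: c[OF that, symmetric] m_assoc)
      finally show ?thesis .
    qed
    with z show "inv z \<in> {z \<in> carrier G. \<forall>a\<in>A. a \<otimes> z = z \<otimes> a}" by auto
  next
    fix z w assume "z \<in> {z \<in> carrier G. \<forall>a\<in>A. a \<otimes> z = z \<otimes> a}" "w \<in> {z \<in> carrier G. \<forall>a\<in>A. a \<otimes> z = z \<otimes> a}"
    moreover from this have "a \<otimes> (z \<otimes> w) = z \<otimes> w \<otimes> a" if "a \<in> A" for a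
    proof -
      have a: "a \<in> carrier G" using that \<open>A \<subseteq> carrier G\<close> by auto
      have z: "z \<in> carrier G" "a \<otimes> z = z \<otimes> a" "w \<in> carrier G" "a \<otimes> w = w \<otimes> a"
        using \<open>z \<in> _\<close> \<open>w \<in> _\<close> that by auto
      have "a \<otimes> (z \<otimes> w) = z \<otimes> a \<otimes> w" using a z by (simp add: m_assoc[symmetric])
      also have "\<dots> = z \<otimes> w \<otimes> a" using a z(1,3) by (simp only: m_assoc z(4))
      finally show ?thesis .
    qed
    ultimately show "z \<otimes> w \<in> {z \<in> carrier G. \<forall>a\<in>A. a \<otimes> z = z \<otimes> a}" by auto
  qed (use that in \<open>auto intro!: exI[of _ \<one>]\<close>)
  have "generate G S \<subseteq> {z \<in> carrier G. \<forall>a\<in>S. a \<otimes> z = z \<otimes> a}"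
    using assms by (intro generate_subgroup_incl centralizer) auto
  then have "generate G S \<subseteq> {z \<in> carrier G. \<forall>a\<in>generate G S. a \<otimes> z = z \<otimes> a}"
    using S by (intro generate_subgroup_incl centralizer generate_incl) fastforce+
  then show ?thesis using x y by auto
qed

section \<open>Regular permutation groups\<close>

lemma Perm_mult_apply:
  assumes "f \<in> carrier (BijGroup S)" "h \<in> carrier (BijGroup S)" "y \<in> S"
  shows "(f \<otimes>\<^bsub>BijGroup S\<^esub> h) y = f (h y)"
  using assms by (simp add: BijGroup_def compose_eq)

lemma Perm_one_apply: "y \<in> S \<Longrightarrow> \<one>\<^bsub>BijGroup S\<^esub> y = y"
  by (simp add: BijGroup_def)

lemma Perm_apply_closed: "f \<in> carrier (BijGroup S) \<Longrightarrow> y \<in> S \<Longrightarrow> f y \<in> S"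
  by (auto simp: BijGroup_def dest: Bij_imp_funcset)

lemma Perm_eqI:
  assumes "f \<in> carrier (BijGroup S)" "h \<in> carrier (BijGroup S)" "\<And>y. y \<in> S \<Longrightarrow> f y = h y"
  shows "f = h"
  using assms by (auto simp: BijGroup_def intro: extensionalityI dest: Bij_imp_extensional)

lemma Perm_inv_apply:
  assumes "f \<in> carrier (BijGroup S)" "y \<in> S" "z \<in> S"
  shows "(inv\<^bsub>BijGroup S\<^esub> f) z = y \<longleftrightarrow> f y = z"
proof -
  interpret P: group "BijGroup S" by (rule group_BijGroup)
  have "f ((inv\<^bsub>BijGroup S\<^esub> f) z) = z"
    using Perm_mult_apply[of f S "inv\<^bsub>BijGroup S\<^esub> f" z] assms by (simp add: Perm_one_apply)
  moreover have "(inv\<^bsub>BijGroup S\<^esub> f) (f y) = y"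
    using Perm_mult_apply[of "inv\<^bsub>BijGroup S\<^esub> f" S f y] assms by (simp add: Perm_one_apply)
  ultimately show ?thesis by auto
qed

text \<open>Regularity is sharp transitivity: some element of \<open>N\<close> takes \<open>y\<close> to \<open>z\<close>, and the
  trivial stabilizers say that it is unique. In this form it passes to conjugates by relabelling
  the points.\<close>

lemma regular_subgroup_iff_sharply_transitive:
  "regular_subgroup G N \<longleftrightarrow> subgroup N (Perm G) \<and>
     (\<forall>y\<in>carrier G. \<forall>z\<in>carrier G. \<exists>!\<nu>. \<nu> \<in> N \<and> \<nu> y = z)"
proof (cases "subgroup N (Perm G)")
  case True
  interpret P: group "Perm G" by (rule group_BijGroup)
  interpret N: subgroup N "Perm G" by (rule True)
  have act: "group_action ((Perm G)\<lparr>carrier := N\<rparr>) (carrier G) (\<lambda>\<nu>. \<nu>)"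
    unfolding group_action_def group_hom_def group_hom_axioms_def
    using N.subgroup_is_group[OF P.is_group] by (auto simp: hom_def P.is_group)
  show ?thesis
  proof
    assume "regular_subgroup G N"
    then have tr: "transitive_action ((Perm G)\<lparr>carrier := N\<rparr>) (carrier G) (\<lambda>\<nu>. \<nu>)"
      and st: "\<And>y. y \<in> carrier G \<Longrightarrow> {\<nu> \<in> N. \<nu> y = y} = {\<one>\<^bsub>Perm G\<^esub>}"
      by (auto simp: regular_subgroup_def stabilizer_def)
    have "\<mu> = \<nu>" if "y \<in> carrier G" "\<mu> \<in> N" "\<nu> \<in> N" "\<mu> y = \<nu> y" for y \<mu> \<nu>
    proof -
      have "(inv\<^bsub>Perm G\<^esub> \<nu> \<otimes>\<^bsub>Perm G\<^esub> \<mu>) y = y"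
        using that by (simp add: Perm_mult_apply Perm_inv_apply Perm_apply_closed)
      then have "inv\<^bsub>Perm G\<^esub> \<nu> \<otimes>\<^bsub>Perm G\<^esub> \<mu> = \<one>\<^bsub>Perm G\<^esub>" using that st[of y] by blast
      moreover have mem: "\<mu> \<in> carrier (Perm G)" "\<nu> \<in> carrier (Perm G)"
        using N.mem_carrier[OF that(2)] N.mem_carrier[OF that(3)] .
      ultimately have "inv\<^bsub>Perm G\<^esub> \<mu> = inv\<^bsub>Perm G\<^esub> \<nu>"
        using P.inv_equality[OF _ mem(1) P.inv_closed[OF mem(2)]] by simp
      then show ?thesis by (rule inj_onD[OF P.inv_inj _ mem])
    qed
    moreover have "\<exists>\<nu>. \<nu> \<in> N \<and> \<nu> y = z" if "y \<in> carrier G" "z \<in> carrier G" for y z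
      using transitive_action.unique_orbit[OF tr that] by auto
    ultimately show "subgroup N (Perm G) \<and>
      (\<forall>y\<in>carrier G. \<forall>z\<in>carrier G. \<exists>!\<nu>. \<nu> \<in> N \<and> \<nu> y = z)"
      using True by metis
  next
    assume R: "subgroup N (Perm G) \<and>
      (\<forall>y\<in>carrier G. \<forall>z\<in>carrier G. \<exists>!\<nu>. \<nu> \<in> N \<and> \<nu> y = z)"
    have "{\<nu> \<in> N. \<nu> y = y} = {\<one>\<^bsub>Perm G\<^esub>}" if "y \<in> carrier G" for y
      using R that N.one_closed Perm_one_apply[OF that] by blast
    moreover have "transitive_action ((Perm G)\<lparr>carrier := N\<rparr>) (carrier G) (\<lambda>\<nu>. \<nu>)"
      using act R by (simp add: transitive_action_def transitive_action_axioms_def) metis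
    ultimately show "regular_subgroup G N"
      using True by (auto simp: regular_subgroup_def stabilizer_def)
  qed
qed (auto simp: regular_subgroup_def)

text \<open>A transitive commutative group acts freely: if \<open>\<mu>\<close> and \<open>\<nu>\<close> agree at one point, then they
  agree at each of its translates, that is, everywhere.\<close>

lemma regular_subgroup_commutativeI:
  assumes "subgroup N (Perm G)" and a: "a \<in> carrier G"
    and comm: "\<And>\<mu> \<nu>. \<mu> \<in> N \<Longrightarrow> \<nu> \<in> N \<Longrightarrow> \<mu> \<otimes>\<^bsub>Perm G\<^esub> \<nu> = \<nu> \<otimes>\<^bsub>Perm G\<^esub> \<mu>"
    and orbit: "\<And>z. z \<in> carrier G \<Longrightarrow> \<exists>\<nu>\<in>N. \<nu> a = z"
  shows "regular_subgroup G N"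
proof -
  interpret N: subgroup N "Perm G" by fact
  have comm': "\<mu> (\<nu> y) = \<nu> (\<mu> y)" if "\<mu> \<in> N" "\<nu> \<in> N" "y \<in> carrier G" for \<mu> \<nu> y
    using comm[OF that(1,2)] that Perm_mult_apply[of \<mu> "carrier G" \<nu> y]
      Perm_mult_apply[of \<nu> "carrier G" \<mu> y] by simp
  have ex: "\<exists>\<nu>\<in>N. \<nu> y = z" if y: "y \<in> carrier G" and z: "z \<in> carrier G" for y z
  proof -
    obtain \<mu> \<nu> where "\<mu> \<in> N" "\<mu> a = y" "\<nu> \<in> N" "\<nu> a = z"
      using orbit[OF y] orbit[OF z] by blast
    moreover have "(\<nu> \<otimes>\<^bsub>Perm G\<^esub> inv\<^bsub>Perm G\<^esub> \<mu>) y = z"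
      using calculation a that Perm_inv_apply[of \<mu> "carrier G" a y]
      by (simp add: Perm_mult_apply N.m_inv_closed group.inv_closed[OF group_BijGroup])
    ultimately show ?thesis using N.m_closed N.m_inv_closed group_BijGroup by blast
  qed
  moreover have "\<mu> = \<nu>" if y: "y \<in> carrier G" and mn: "\<mu> \<in> N" "\<nu> \<in> N" and eq: "\<mu> y = \<nu> y" for y \<mu> \<nu>
  proof (rule Perm_eqI)
    fix z assume "z \<in> carrier G"
    then obtain \<kappa> where "\<kappa> \<in> N" "\<kappa> y = z" using ex y by blast
    then show "\<mu> z = \<nu> z" using comm' mn y eq by metis
  qed (use mn in auto)
  ultimately show ?thesis
    unfolding regular_subgroup_iff_sharply_transitive using assms(1) by metis
qed

section \<open>Left and right translations\<close>

context group
begin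

lemma left_mult_apply: "y \<in> carrier G \<Longrightarrow> left_mult G x y = x \<otimes> y"
  by (simp add: left_mult_def)

lemma right_mult_apply: "y \<in> carrier G \<Longrightarrow> right_mult G x y = y \<otimes> inv x"
  by (simp add: right_mult_def)

lemma left_mult_in_Perm:
  assumes "x \<in> carrier G"
  shows "left_mult G x \<in> carrier (Perm G)"
proof -
  have "bij_betw (left_mult G x) (carrier G) (carrier G)"
    by (rule bij_betwI[where g = "\<lambda>y. inv x \<otimes> y"])
       (use assms in \<open>auto simp: left_mult_def m_assoc[symmetric]\<close>)
  then show ?thesis by (simp add: BijGroup_def Bij_def left_mult_def)
qed

lemma right_mult_in_Perm:
  assumes "x \<in> carrier G"
  shows "right_mult G x \<in> carrier (Perm G)"
proof -
  have "bij_betw (right_mult G x) (carrier G) (carrier G)"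
    by (rule bij_betwI[where g = "\<lambda>y. y \<otimes> x"])
       (use assms in \<open>auto simp: right_mult_def m_assoc\<close>)
  then show ?thesis by (simp add: BijGroup_def Bij_def right_mult_def)
qed

lemma group_hom_left_mult: "group_hom G (Perm G) (left_mult G)"
proof (intro group_hom.intro group_hom_axioms.intro homI is_group group_BijGroup left_mult_in_Perm)
  fix x y assume "x \<in> carrier G" "y \<in> carrier G"
  moreover have "left_mult G x \<otimes>\<^bsub>Perm G\<^esub> left_mult G y \<in> carrier (Perm G)"
    if "x \<in> carrier G" "y \<in> carrier G"
    using that by (intro monoid.m_closed[OF group.is_monoid[OF group_BijGroup]] left_mult_in_Perm)
  ultimately show "left_mult G (x \<otimes> y) = left_mult G x \<otimes>\<^bsub>Perm G\<^esub> left_mult G y"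
    by (intro Perm_eqI[where S = "carrier G"])
       (simp_all add: Perm_mult_apply left_mult_in_Perm left_mult_apply m_assoc)
qed

lemma group_hom_right_mult: "group_hom G (Perm G) (right_mult G)"
proof (intro group_hom.intro group_hom_axioms.intro homI is_group group_BijGroup right_mult_in_Perm)
  fix x y assume "x \<in> carrier G" "y \<in> carrier G"
  moreover have "right_mult G x \<otimes>\<^bsub>Perm G\<^esub> right_mult G y \<in> carrier (Perm G)"
    if "x \<in> carrier G" "y \<in> carrier G"
    using that by (intro monoid.m_closed[OF group.is_monoid[OF group_BijGroup]] right_mult_in_Perm)
  ultimately show "right_mult G (x \<otimes> y) = right_mult G x \<otimes>\<^bsub>Perm G\<^esub> right_mult G y"
    by (intro Perm_eqI[where S = "carrier G"])
       (simp_all add: Perm_mult_apply right_mult_in_Perm right_mult_apply m_assoc inv_mult_group)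
qed

lemma left_right_mult_commute:
  assumes "x \<in> carrier G" "y \<in> carrier G"
  shows "left_mult G x \<otimes>\<^bsub>Perm G\<^esub> right_mult G y = right_mult G y \<otimes>\<^bsub>Perm G\<^esub> left_mult G x"
  using assms group.is_monoid[OF group_BijGroup, of "carrier G"]
  by (intro Perm_eqI[where S = "carrier G"])
     (simp_all add: Perm_mult_apply left_mult_in_Perm right_mult_in_Perm left_mult_apply
        right_mult_apply m_assoc monoid.m_closed)

text \<open>Conjugation by \<open>\<rho>(x)\<close> preserves all the structure in question. It relabels the points, so it
  keeps regularity, and it commutes with the action of \<open>G\<close> because left and right translations
  commute; so it is itself the required isomorphism.\<close>

lemma rho_conjugate_and_G_isomorphic:
  assumes x: "x \<in> carrier G" and reg: "regular_subgroup G N" and stable: "G_stable G N"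
    and M: "M = right_mult G x <#\<^bsub>Perm G\<^esub> N #>\<^bsub>Perm G\<^esub> inv\<^bsub>Perm G\<^esub> (right_mult G x)"
  shows "rho_conjugate G N M \<and> G_isomorphic G N M"
proof -
  interpret P: group "Perm G" by (rule group_BijGroup)
  let ?r = "right_mult G x"
  define c where "c = (\<lambda>\<nu>. ?r \<otimes>\<^bsub>Perm G\<^esub> \<nu> \<otimes>\<^bsub>Perm G\<^esub> inv\<^bsub>Perm G\<^esub> ?r)"
  have r: "?r \<in> carrier (Perm G)" using x by (rule right_mult_in_Perm)
  interpret c: group_hom "Perm G" "Perm G" c
    unfolding c_def using r by (rule P.group_hom_conj)
  have image: "M = c ` N" unfolding M c_def by (rule P.conj_coset_eq_image)
  have sub: "subgroup N (Perm G)"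
    and sharp: "\<And>y z. y \<in> carrier G \<Longrightarrow> z \<in> carrier G \<Longrightarrow> \<exists>!\<nu>. \<nu> \<in> N \<and> \<nu> y = z"
    using reg unfolding regular_subgroup_iff_sharply_transitive by auto
  interpret N: subgroup N "Perm G" by (rule sub)
  have inj: "inj_on c N"
    using r by (intro inj_onI) (simp add: c_def)
  have c_apply: "c \<nu> y = z \<longleftrightarrow> \<nu> ((inv\<^bsub>Perm G\<^esub> ?r) y) = (inv\<^bsub>Perm G\<^esub> ?r) z"
    if "\<nu> \<in> N" "y \<in> carrier G" "z \<in> carrier G" for \<nu> y z
  proof -
    have "c \<nu> y = ?r (\<nu> ((inv\<^bsub>Perm G\<^esub> ?r) y))"
      using that r by (simp add: c_def Perm_mult_apply Perm_apply_closed)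
    moreover have "\<nu> ((inv\<^bsub>Perm G\<^esub> ?r) y) \<in> carrier G"
      using Perm_apply_closed[OF N.mem_carrier Perm_apply_closed[OF P.inv_closed]] that r by blast
    ultimately show ?thesis using Perm_inv_apply[OF r _ that(3)] by (metis (no_types))
  qed
  have "regular_subgroup G M"
    unfolding regular_subgroup_iff_sharply_transitive
  proof (intro conjI ballI)
    show "subgroup M (Perm G)" unfolding image using sub by (rule c.subgroup_img_is_subgroup)
  next
    fix y z assume yz: "y \<in> carrier G" "z \<in> carrier G"
    have "(inv\<^bsub>Perm G\<^esub> ?r) y \<in> carrier G" "(inv\<^bsub>Perm G\<^esub> ?r) z \<in> carrier G"
      using Perm_apply_closed[OF P.inv_closed[OF r]] yz by blast+
    from sharp[OF this] obtain \<nu> where \<nu>: "\<nu> \<in> N" "\<nu> ((inv\<^bsub>Perm G\<^esub> ?r) y) = (inv\<^bsub>Perm G\<^esub> ?r) z"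
      and unique: "\<And>\<mu>. \<mu> \<in> N \<Longrightarrow> \<mu> ((inv\<^bsub>Perm G\<^esub> ?r) y) = (inv\<^bsub>Perm G\<^esub> ?r) z \<Longrightarrow> \<mu> = \<nu>"
      by blast
    show "\<exists>!\<mu>. \<mu> \<in> M \<and> \<mu> y = z"
    proof (intro ex1I[of _ "c \<nu>"] conjI)
      show "c \<nu> \<in> M" using \<nu>(1) by (simp add: image)
      show "c \<nu> y = z" using c_apply[OF \<nu>(1) yz] \<nu>(2) by blast
    next
      fix \<mu> assume "\<mu> \<in> M \<and> \<mu> y = z"
      then obtain \<kappa> where \<kappa>: "\<kappa> \<in> N" "\<mu> = c \<kappa>" "c \<kappa> y = z" unfolding image by blast
      then have "\<kappa> = \<nu>" using c_apply[OF \<kappa>(1) yz] unique by blast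
      then show "\<mu> = c \<nu>" using \<kappa>(2) by simp
    qed
  qed
  moreover have equivariant: "c (perm_act G y \<nu>) = perm_act G y (c \<nu>)"
    if "y \<in> carrier G" "\<nu> \<in> N" for y \<nu>
    using that x r unfolding c_def perm_act_def
    by (simp add: P.conj_conj left_mult_in_Perm left_right_mult_commute)
  then have "G_stable G M"
    using stable unfolding G_stable_def image by (metis (no_types, lifting) imageE imageI)
  moreover have "c \<in> iso ((Perm G)\<lparr>carrier := N\<rparr>) ((Perm G)\<lparr>carrier := M\<rparr>)"
    using inj unfolding iso_def hom_def image by (auto simp: bij_betw_def)
  ultimately show ?thesis
    using assms equivariant unfolding rho_conjugate_def G_isomorphic_def by blast
qed

end

section \<open>The subgroups \<open>N\<^sub>s\<close>\<close>

context group
begin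

text \<open>The two translations commute, and products of their powers
  take \<open>1\<close> to every \<open>s\<^sup>i t\<^sup>j\<close>. Stability holds because the action of \<open>G\<close> fixes \<open>\<rho>(t\<^sup>-\<^sup>1)\<close> and takes
  \<open>\<lambda>(s)\<close> to \<open>\<lambda>(x s x\<^sup>-\<^sup>1)\<close>, a power of \<open>\<lambda>(s)\<close>.\<close>

lemma generate_translations_regular_stable:
  assumes s: "s \<in> carrier G" and t: "t \<in> carrier G"
    and factor: "\<And>x. x \<in> carrier G \<Longrightarrow> \<exists>(i :: nat) (j :: nat). x = s [^] i \<otimes> t [^] j"
    and normal: "\<And>x. x \<in> carrier G \<Longrightarrow> \<exists>k :: int. x \<otimes> s \<otimes> inv x = s [^] k"
    and N: "N = generate (Perm G) {left_mult G s, right_mult G (inv t)}"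
  shows "regular_subgroup G N" and "G_stable G N"
proof -
  interpret P: group "Perm G" by (rule group_BijGroup)
  interpret L: group_hom G "Perm G" "left_mult G" by (rule group_hom_left_mult)
  interpret R: group_hom G "Perm G" "right_mult G" by (rule group_hom_right_mult)
  let ?S = "{left_mult G s, right_mult G (inv t)}"
  have S: "?S \<subseteq> carrier (Perm G)" using s t by simp
  have sub: "subgroup N (Perm G)" unfolding N using S by (rule P.generate_is_subgroup)
  interpret N: subgroup N "Perm G" by (rule sub)
  have gens: "left_mult G s \<in> N" "right_mult G (inv t) \<in> N"
    unfolding N by (auto intro: generate.incl)
  show "regular_subgroup G N"
  proof (rule regular_subgroup_commutativeI[OF sub one_closed])
    fix \<mu> \<nu> assume "\<mu> \<in> N" "\<nu> \<in> N"
    then show "\<mu> \<otimes>\<^bsub>Perm G\<^esub> \<nu> = \<nu> \<otimes>\<^bsub>Perm G\<^esub> \<mu>"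
      unfolding N by (rule P.generate_commute[OF S, rotated]) (use left_right_mult_commute[OF s inv_closed[OF t]] in \<open>auto simp del: R.hom_inv\<close>)
  next
    fix z assume "z \<in> carrier G"
    from factor[OF this] obtain i j :: nat where z: "z = s [^] i \<otimes> t [^] j"
      by blast
    let ?\<nu> = "left_mult G (s [^] i) \<otimes>\<^bsub>Perm G\<^esub> right_mult G (inv t [^] j)"
    have "left_mult G (s [^] int i) \<in> N"
      using P.subgroup_int_pow_closed[OF sub gens(1)] s by (simp add: L.hom_int_pow)
    moreover have "right_mult G (inv t [^] int j) \<in> N"
      using P.subgroup_int_pow_closed[OF sub gens(2)] R.hom_int_pow[OF inv_closed[OF t], of "int j"]
      by simp
    ultimately have "?\<nu> \<in> N" by (simp add: int_pow_int)
    moreover have "?\<nu> \<one> = z"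
      using s t by (simp add: z Perm_mult_apply left_mult_apply right_mult_apply nat_pow_inv del: R.hom_inv)
    ultimately show "\<exists>\<nu>\<in>N. \<nu> \<one> = z" by blast
  qed
  show "G_stable G N"
    unfolding G_stable_def
  proof (intro ballI)
    fix x \<nu> assume x: "x \<in> carrier G" and "\<nu> \<in> N"
    have act: "group_hom (Perm G) (Perm G) (perm_act G x)"
      unfolding perm_act_def using x by (intro P.group_hom_conj) simp
    obtain k :: int where "x \<otimes> s \<otimes> inv x = s [^] k" using normal[OF x] by auto
    moreover have "perm_act G x (left_mult G s) = left_mult G (x \<otimes> s \<otimes> inv x)"
      using x s by (simp add: perm_act_def)
    ultimately have "perm_act G x (left_mult G s) \<in> N"
      using s gens P.subgroup_int_pow_closed[OF sub] by (simp add: L.hom_int_pow)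
    moreover have "perm_act G x (right_mult G (inv t)) = right_mult G (inv t)"
      unfolding perm_act_def left_right_mult_commute[OF x inv_closed[OF t]]
      using x t by (simp add: P.m_assoc del: R.hom_inv)
    ultimately have "generate (Perm G) (perm_act G x ` ?S) \<subseteq> N"
      using gens by (intro P.generate_subgroup_incl sub) auto
    then show "perm_act G x \<nu> \<in> N"
      using group_hom.generate_img[OF act S] \<open>\<nu> \<in> N\<close> N by blast
  qed
qed

text \<open>Conjugation by \<open>c\<close> is \<open>\<lambda>(c)\<rho>(c)\<close>. If \<open>\<lambda>(c)\<close> lies in \<open>N\<close>, only the factor \<open>\<rho>(c)\<close> moves \<open>N\<close>,
  so conjugating \<open>N\<close> by a power of this inner automorphism amounts to a \<open>\<rho>\<close>-conjugation.\<close>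

lemma conj_subgroup_inner_eq_rho_conjugate:
  assumes c: "c \<in> carrier G" and sub: "subgroup N (Perm G)" and cN: "left_mult G c \<in> N"
    and \<psi>: "\<psi> = left_mult G c \<otimes>\<^bsub>Perm G\<^esub> right_mult G c"
  shows "conj_subgroup G \<psi> N n =
    right_mult G (c [^] (- int n)) <#\<^bsub>Perm G\<^esub> N
      #>\<^bsub>Perm G\<^esub> inv\<^bsub>Perm G\<^esub> (right_mult G (c [^] (- int n)))"
proof -
  interpret P: group "Perm G" by (rule group_BijGroup)
  interpret L: group_hom G "Perm G" "left_mult G" by (rule group_hom_left_mult)
  interpret R: group_hom G "Perm G" "right_mult G" by (rule group_hom_right_mult)
  interpret N: subgroup N "Perm G" by (rule sub)
  let ?l = "left_mult G (c [^] (- int n))" and ?r = "right_mult G (c [^] (- int n))"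
  have closed: "?l \<in> carrier (Perm G)" "?r \<in> carrier (Perm G)" using c by auto
  have pow: "\<psi> [^]\<^bsub>Perm G\<^esub> k = left_mult G (c [^] k) \<otimes>\<^bsub>Perm G\<^esub> right_mult G (c [^] k)" for k :: int
    unfolding \<psi> using c by (simp add: P.int_pow_mult_distrib[OF left_right_mult_commute[OF c c]] L.hom_int_pow R.hom_int_pow)
  have neg: "\<psi> [^]\<^bsub>Perm G\<^esub> (- int n) = ?r \<otimes>\<^bsub>Perm G\<^esub> ?l"
    using c by (simp add: pow left_right_mult_commute)
  have pos: "\<psi> [^]\<^bsub>Perm G\<^esub> n = inv\<^bsub>Perm G\<^esub> ?l \<otimes>\<^bsub>Perm G\<^esub> inv\<^bsub>Perm G\<^esub> ?r"
    using pow[of "int n"] c by (simp add: int_pow_int int_pow_neg)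
  have "?l \<in> N" using cN c P.subgroup_int_pow_closed[OF sub] by (simp add: L.hom_int_pow)
  have "conj_subgroup G \<psi> N n =
    (\<lambda>\<nu>. ?r \<otimes>\<^bsub>Perm G\<^esub> (?l \<otimes>\<^bsub>Perm G\<^esub> \<nu> \<otimes>\<^bsub>Perm G\<^esub> inv\<^bsub>Perm G\<^esub> ?l) \<otimes>\<^bsub>Perm G\<^esub> inv\<^bsub>Perm G\<^esub> ?r) ` N"
    unfolding conj_subgroup_def neg pos P.conj_coset_eq_image
    using closed by (intro image_cong) (simp_all add: P.m_assoc)
  also have "\<dots> = ?r <#\<^bsub>Perm G\<^esub> (?l <#\<^bsub>Perm G\<^esub> N #>\<^bsub>Perm G\<^esub> inv\<^bsub>Perm G\<^esub> ?l) #>\<^bsub>Perm G\<^esub> inv\<^bsub>Perm G\<^esub> ?r"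
    by (simp add: P.conj_coset_eq_image image_image)
  also have "?l <#\<^bsub>Perm G\<^esub> N #>\<^bsub>Perm G\<^esub> inv\<^bsub>Perm G\<^esub> ?l = N"
    using sub \<open>?l \<in> N\<close> closed by (simp add: P.coset_join3 P.coset_join2)
  finally show ?thesis .
qed

text \<open>The elements that conjugate \<open>s\<close> into \<open>\<langle>s\<rangle>\<close> are closed under products, so it is enough to
  look at generators.\<close>

lemma conj_into_powers:
  assumes s: "s \<in> carrier G" and t: "t \<in> carrier G" and ts: "t \<otimes> s \<otimes> inv t = s [^] (g :: int)"
  shows "\<exists>k :: int. (s [^] (i :: nat) \<otimes> t [^] (j :: nat)) \<otimes> s \<otimes> inv (s [^] i \<otimes> t [^] j) = s [^] k"
proof -
  have conj_pow: "x \<otimes> s [^] k \<otimes> inv x = (x \<otimes> s \<otimes> inv x) [^] k" if "x \<in> carrier G" for x and k :: int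
    using group_hom.hom_int_pow[OF group_hom_conj[OF that] s] .
  have "\<exists>k :: int. t [^] j \<otimes> s \<otimes> inv (t [^] j) = s [^] k"
  proof (induction j)
    case 0
    show ?case using s by (intro exI[of _ 1]) simp
  next
    case (Suc j)
    then obtain k :: int where k: "t [^] j \<otimes> s \<otimes> inv (t [^] j) = s [^] k" by blast
    have "t [^] Suc j \<otimes> s \<otimes> inv (t [^] Suc j) = t [^] j \<otimes> s [^] g \<otimes> inv (t [^] j)"
      using s t by (simp add: conj_conj flip: ts)
    also have "\<dots> = s [^] (k * g)" using s t by (simp add: conj_pow k int_pow_pow)
    finally show ?case by blast
  qed
  then obtain k :: int where k: "t [^] j \<otimes> s \<otimes> inv (t [^] j) = s [^] k" by blast
  have "s [^] i \<otimes> s \<otimes> inv (s [^] i) = s"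
    using s by (simp add: nat_pow_comm[of s i 1, simplified] m_assoc)
  then have "(s [^] i \<otimes> t [^] j) \<otimes> s \<otimes> inv (s [^] i \<otimes> t [^] j) = s [^] k"
    using s t by (simp add: conj_pow k flip: conj_conj)
  then show ?thesis by blast
qed

text \<open>Conjugating \<open>t\<close> by \<open>s\<^sup>m\<close> gives \<open>s\<close> to the power \<open>m (1 - g)\<close>, times \<open>t\<close>; as \<open>1 - g\<close> is
  invertible modulo the order of \<open>s\<close>, a suitable \<open>m\<close> produces \<open>s t\<close>.\<close>

lemma ex_conj_eq_mult:
  assumes s: "s \<in> carrier G" and t: "t \<in> carrier G" and ts: "t \<otimes> s \<otimes> inv t = s [^] (g :: int)"
    and cop: "coprime (1 - g) (int (ord s))"
  shows "\<exists>m :: int. s [^] m \<otimes> t \<otimes> inv (s [^] m) = s \<otimes> t"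
proof -
  obtain m where m: "[(1 - g) * m = 1] (mod int (ord s))"
    using cong_solve_coprime_int[OF cop] by blast
  have "t \<otimes> inv (s [^] m) \<otimes> inv t = s [^] (- (g * m))"
    using group_hom.hom_int_pow[OF group_hom_conj[OF t] s, of "- m"] s
    by (simp add: ts int_pow_neg int_pow_pow)
  have "s [^] m \<otimes> t \<otimes> inv (s [^] m) = s [^] m \<otimes> (t \<otimes> inv (s [^] m) \<otimes> inv t) \<otimes> t"
    using s t by (simp add: m_assoc)
  also have "\<dots> = s [^] m \<otimes> s [^] (- (g * m)) \<otimes> t"
    by (simp only: \<open>t \<otimes> inv (s [^] m) \<otimes> inv t = s [^] (- (g * m))\<close>)
  also have "s [^] m \<otimes> s [^] (- (g * m)) = s [^] ((1 - g) * m)"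
    using int_pow_mult[OF s, of m "- (g * m)"] by (simp add: left_diff_distrib)
  also have "\<dots> = s [^] (1 :: int)"
    using m s int_pow_eq[of s "(1 - g) * m" 1] by (simp add: cong_iff_dvd_diff dvd_diff_commute)
  finally show ?thesis using s by auto
qed

text \<open>Conjugation by \<open>c\<close>, as a permutation, is \<open>\<lambda>(c)\<rho>(c)\<close>; an endomorphism that agrees with it on
  generators is equal to it.\<close>

lemma auto_eq_conj_translation:
  assumes s: "s \<in> carrier G" and t: "t \<in> carrier G" and c: "c \<in> carrier G"
    and factor: "\<And>x. x \<in> carrier G \<Longrightarrow> \<exists>(i :: nat) (j :: nat). x = s [^] i \<otimes> t [^] j"
    and \<psi>: "\<psi> \<in> auto G" "\<psi> s = c \<otimes> s \<otimes> inv c" "\<psi> t = c \<otimes> t \<otimes> inv c"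
  shows "\<psi> = left_mult G c \<otimes>\<^bsub>Perm G\<^esub> right_mult G c"
proof (rule Perm_eqI)
  interpret P: group "Perm G" by (rule group_BijGroup)
  show "\<psi> \<in> carrier (Perm G)" using \<psi>(1) by (simp add: auto_def BijGroup_def)
  show "left_mult G c \<otimes>\<^bsub>Perm G\<^esub> right_mult G c \<in> carrier (Perm G)"
    using c by (intro P.m_closed left_mult_in_Perm right_mult_in_Perm)
  interpret \<psi>: group_hom G G \<psi>
    using \<psi>(1) by (unfold_locales) (simp add: auto_def)
  interpret c: group_hom G G "\<lambda>x. c \<otimes> x \<otimes> inv c" using c by (rule group_hom_conj)
  fix y assume y: "y \<in> carrier G"
  from factor[OF this] obtain i j :: nat where ij: "y = s [^] i \<otimes> t [^] j"
    by blast
  have "\<psi> y = (c \<otimes> s \<otimes> inv c) [^] i \<otimes> (c \<otimes> t \<otimes> inv c) [^] j"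
    using s t by (simp add: ij \<psi>(2,3) \<psi>.hom_nat_pow)
  also have "\<dots> = c \<otimes> y \<otimes> inv c"
    unfolding ij
    using s t by (simp only: c.hom_nat_pow[symmetric] c.hom_mult[symmetric] nat_pow_closed)
  finally show "\<psi> y = (left_mult G c \<otimes>\<^bsub>Perm G\<^esub> right_mult G c) y"
    using c y by (simp add: Perm_mult_apply left_mult_in_Perm right_mult_in_Perm left_mult_apply
      right_mult_apply m_assoc)
qed

end

theorem proposition8p2:
  fixes G :: "('a, 'b) monoid_scheme" (structure)
    and p q :: nat and g :: int
    and \<sigma> \<tau> :: 'a and \<eta> \<pi> \<psi> :: "'a \<Rightarrow> 'a"
    and N :: "('a \<Rightarrow> 'a) set"
  assumes "prime p" and "prime q" and "p > q" and "[p = 1] (mod q)"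
    and "ord (int p) g = q"
    and "group G" and "\<not> comm_group G" and "order G = p * q"
    and "\<sigma> \<in> carrier G" and "\<tau> \<in> carrier G"
    and "carrier G = {\<sigma> [^] i \<otimes> \<tau> [^] j | i j :: nat. i \<le> p - 1 \<and> j \<le> q - 1}"
    and "group.ord G \<sigma> = p" and "group.ord G \<tau> = q"
    and "\<tau> \<otimes> \<sigma> \<otimes> inv \<tau> = \<sigma> [^] g"
    and "\<eta> \<in> carrier (Perm G)"
    and "\<And>k l :: nat. k \<le> p - 1 \<Longrightarrow> l \<le> q - 1 \<Longrightarrow>
           \<eta> (\<sigma> [^] k \<otimes> \<tau> [^] l) = \<sigma> [^] (k + 1) \<otimes> \<tau> [^] l"
    and "\<pi> \<in> carrier (Perm G)"
    and "\<And>k l :: nat. k \<le> p - 1 \<Longrightarrow> l \<le> q - 1 \<Longrightarrow>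
           \<pi> (\<sigma> [^] k \<otimes> \<tau> [^] l) = \<sigma> [^] k \<otimes> \<tau> [^] (l + 1)"
    and "N = generate (Perm G) {\<eta>, \<pi>}"
    and "\<psi> \<in> auto G" and "\<psi> \<sigma> = \<sigma>" and "\<psi> \<tau> = \<sigma> \<otimes> \<tau>"
  shows "\<forall>s\<le>p - 1. \<forall>t\<le>p - 1.
           rho_conjugate G (conj_subgroup G \<psi> N s) (conj_subgroup G \<psi> N t) \<and>
           G_isomorphic G (conj_subgroup G \<psi> N s) (conj_subgroup G \<psi> N t)"
proof (intro allI impI)
  fix s t :: nat assume "s \<le> p - 1" "t \<le> p - 1"
  interpret G: group G by fact
  interpret P: group "Perm G" by (rule group_BijGroup)
  note \<sigma> = \<open>\<sigma> \<in> carrier G\<close> and \<tau> = \<open>\<tau> \<in> carrier G\<close>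
  have factor: "\<exists>i j :: nat. i \<le> p - 1 \<and> j \<le> q - 1 \<and> x = \<sigma> [^] i \<otimes> \<tau> [^] j" if "x \<in> carrier G" for x
    using that assms(11) by auto
  then have factor': "\<exists>(i :: nat) (j :: nat). x = \<sigma> [^] i \<otimes> \<tau> [^] j" if "x \<in> carrier G" for x
    using factor[OF that] by blast

  have \<eta>: "\<eta> = left_mult G \<sigma>"
  proof (rule Perm_eqI[OF assms(15) G.left_mult_in_Perm[OF \<sigma>]])
    fix y assume "y \<in> carrier G"
    from factor[OF this] obtain i j :: nat
      where ij: "i \<le> p - 1" "j \<le> q - 1" and y: "y = \<sigma> [^] i \<otimes> \<tau> [^] j" by blast
    have "\<eta> y = \<sigma> [^] (i + 1) \<otimes> \<tau> [^] j" unfolding y using ij by (rule assms(16))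
    also have "\<sigma> [^] (i + 1) = \<sigma> \<otimes> \<sigma> [^] i" using G.nat_pow_Suc2[OF \<sigma>] by simp
    finally show "\<eta> y = left_mult G \<sigma> y"
      using \<sigma> \<tau> by (simp add: y G.left_mult_apply G.m_assoc)
  qed
  have \<pi>: "\<pi> = right_mult G (inv \<tau>)"
  proof (rule Perm_eqI[OF assms(17) G.right_mult_in_Perm[OF G.inv_closed[OF \<tau>]]])
    fix y assume "y \<in> carrier G"
    from factor[OF this] obtain i j :: nat
      where ij: "i \<le> p - 1" "j \<le> q - 1" and y: "y = \<sigma> [^] i \<otimes> \<tau> [^] j" by blast
    have "\<pi> y = \<sigma> [^] i \<otimes> \<tau> [^] (j + 1)" unfolding y using ij by (rule assms(18))
    then show "\<pi> y = right_mult G (inv \<tau>) y"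
      using \<sigma> \<tau> by (simp add: y G.right_mult_apply G.m_assoc)
  qed
  have N: "N = generate (Perm G) {left_mult G \<sigma>, right_mult G (inv \<tau>)}"
    using assms(19) \<eta> \<pi> by simp
  have normal: "\<exists>k :: int. x \<otimes> \<sigma> \<otimes> inv x = \<sigma> [^] k" if "x \<in> carrier G" for x
  proof -
    from factor'[OF that] obtain i j :: nat where x: "x = \<sigma> [^] i \<otimes> \<tau> [^] j"
      by blast
    show ?thesis unfolding x by (rule G.conj_into_powers[OF \<sigma> \<tau> assms(14)])
  qed
  note reg = G.generate_translations_regular_stable(1)[OF \<sigma> \<tau> factor' normal N]
    and stable = G.generate_translations_regular_stable(2)[OF \<sigma> \<tau> factor' normal N]
  have sub: "subgroup N (Perm G)" using reg by (simp add: regular_subgroup_def)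

  \<comment> \<open>Since \<open>g\<close> has order \<open>q > 1\<close>, it is not \<open>1\<close> modulo \<open>p\<close>.\<close>
  have "\<not> [g = 1] (mod int p)"
  proof
    assume "[g = 1] (mod int p)"
    then have "(LEAST d. 0 < d \<and> [g ^ d = 1] (mod int p)) = 1"
      by (intro Least_equality) auto
    then have "q \<le> 1"
      using \<open>ord (int p) g = q\<close> by (auto simp: ord_def split: if_splits)
    then show False using prime_gt_1_nat[OF \<open>prime q\<close>] by simp
  qed
  then have "\<not> int p dvd 1 - g"
    by (simp add: cong_iff_dvd_diff dvd_diff_commute)
  then have "coprime (1 - g) (int (group.ord G \<sigma>))"
    using \<open>prime p\<close> \<open>group.ord G \<sigma> = p\<close> prime_imp_coprime[of "int p" "1 - g"]
    by (simp add: coprime_commute)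
  then obtain m :: int where m: "\<sigma> [^] m \<otimes> \<tau> \<otimes> inv (\<sigma> [^] m) = \<sigma> \<otimes> \<tau>"
    using G.ex_conj_eq_mult[OF \<sigma> \<tau> assms(14)] by blast
  define c where "c = \<sigma> [^] m"
  have c: "c \<in> carrier G" using \<sigma> by (simp add: c_def)
  have "c \<otimes> \<sigma> \<otimes> inv c = \<sigma>"
  proof -
    have "c \<otimes> \<sigma> = \<sigma> \<otimes> c"
      using G.int_pow_mult[OF \<sigma>, of m 1] G.int_pow_mult[OF \<sigma>, of 1 m] \<sigma> by (simp add: c_def add.commute)
    then show ?thesis using c \<sigma> by (simp add: G.m_assoc)
  qed
  then have \<psi>: "\<psi> = left_mult G c \<otimes>\<^bsub>Perm G\<^esub> right_mult G c"
    using G.auto_eq_conj_translation[OF \<sigma> \<tau> c factor' assms(20)] assms(21,22) m c_def by simp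
  have "left_mult G c \<in> N"
  proof -
    have "left_mult G \<sigma> \<in> N" unfolding N by (auto intro: generate.incl)
    then show ?thesis
      using P.subgroup_int_pow_closed[OF sub] group_hom.hom_int_pow[OF G.group_hom_left_mult \<sigma>]
      by (simp add: c_def)
  qed
  note conj = G.conj_subgroup_inner_eq_rho_conjugate[OF c sub this \<psi>]

  define a where "a = c [^] (- int s)"
  define b where "b = c [^] (- int t)"
  have ab: "a \<in> carrier G" "b \<in> carrier G" using c by (simp_all add: a_def b_def)
  interpret R: group_hom G "Perm G" "right_mult G" by (rule G.group_hom_right_mult)
  let ?Ns = "conj_subgroup G \<psi> N s" and ?Nt = "conj_subgroup G \<psi> N t"
  have "rho_conjugate G N ?Ns"
    using G.rho_conjugate_and_G_isomorphic[OF ab(1) reg stable] conj[of s] by (simp add: a_def)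
  then have Ns: "regular_subgroup G ?Ns" "G_stable G ?Ns"
    by (auto simp: rho_conjugate_def)
  have Nt: "?Nt = right_mult G (b \<otimes> inv a) <#\<^bsub>Perm G\<^esub> ?Ns
      #>\<^bsub>Perm G\<^esub> inv\<^bsub>Perm G\<^esub> (right_mult G (b \<otimes> inv a))"
    using P.conj_set_shift[of "right_mult G a" "right_mult G b" N] subgroup.subset[OF sub] ab
      conj[of s] conj[of t]
    by (simp add: a_def b_def)
  show "rho_conjugate G ?Ns ?Nt \<and> G_isomorphic G ?Ns ?Nt"
    by (rule G.rho_conjugate_and_G_isomorphic[OF _ Ns Nt]) (use ab in simp)
qed

end
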